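(* Let $A\in\mathbb C^{n\times n}$ be a matrix for which $G(A)$ is a regular $D$-dimensional $N_1\times\cdots\times N_D$ lattice, and let $f$ be a scalar function such that $f(A)$ is defined and has exponential decay, i.e., there are constants $C>0$ and $0\le q<1$ such that $|[f(A)]_{ij}|\le C\,q^{\mathrm d(i,j)}$ for all $i,j\in\{1,\dots,n\}$. Let $d$ be a positive integer. Identify each node with its lattice coordinates $w=(w^{[1]},\dots,w^{[D]})$, $0\le w^{[k]}\le N_k-1$, and consider the distance-$d$ coloring with $(d+1)^D$ colors $$\mathrm{col}(w)=\Big(\sum_{k=1}^{D}\widetilde{w^{[k]}}(d+1)^{k-1}\Big)+1,\qquad \widetilde{w^{[k]}}=w^{[k]}\bmod(d+1).$$ Let $V_\ell$ be the set of nodes of color $\ell$, $v_\ell=\sum_{i\in V_\ell}e_i$ for $\ell=1,\dots,(d+1)^D$, and $\mathcal T(f(A))=\sum_{\ell=1}^{(d+1)^D}v_\ell^Hf(A)v_\ell$. Then $$|\mathrm{tr}(f(A))-\mathcal T(f(A))|\le 2CDn\,\mathrm{Li}_{1-D}(q^d).$$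
   Context: The graph $G(A)$ of $A$ has vertices $\{1,\dots,n\}$ and edges $\{(i,j): a_{ij}\ne0,\ i\ne j\}$; $\mathrm d(i,j)$ is the geodesic distance from $i$ to $j$ in $G(A)$. In the regular $D$-dimensional $N_1\times\cdots\times N_D$ lattice the nodes are the integer vectors $w=(w^{[1]},\dots,w^{[D]})$ with $0\le w^{[k]}\le N_k-1$ (so $n=N_1\cdots N_D$), two nodes being adjacent (in both directions) exactly when their difference has 1-norm equal to $1$; thus $\mathrm d(v,w)=\|v-w\|_1=\sum_{k=1}^D|v^{[k]}-w^{[k]}|$. A distance-$d$ coloring assigns different colors to distinct nodes at distance at most $d$. $e_i$ is the $i$th canonical unit vector. The polylogarithm is $\mathrm{Li}_s(z)=\sum_{i=1}^\infty z^i/i^s$ (for $|z|<1$). $f(A)$ is the usual matrix function (polynomial in $A$ interpolating $f$ on the spectrum of $A$ in the Hermite sense). *)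

theory Defs
  imports
    "HOL-Analysis.Derivative"
    "HOL-Library.FuncSet"
    "Jordan_Normal_Form.Jordan_Normal_Form"
begin

definition mat_trace :: "complex mat \<Rightarrow> complex" where
  "mat_trace M = (\<Sum>i<dim_row M. M $$ (i, i))"

text \<open>Matrices are indexed from \<open>0\<close>, so the nodes of a graph on \<open>n\<close> vertices are
  \<open>0, \<dots>, n - 1\<close>. A (directed) graph is represented by its set of edges.\<close>

definition mat_graph :: "complex mat \<Rightarrow> (nat \<times> nat) set" where
  "mat_graph A = {(i, j). i < dim_row A \<and> j < dim_col A \<and> i \<noteq> j \<and> A $$ (i, j) \<noteq> 0}"

text \<open>The length of a shortest walk. The value is unspecified if there is no walk, which does not
  happen in a lattice (see \<open>graph_dist_lattice\<close> below).\<close>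

definition graph_dist :: "('a \<times> 'a) set \<Rightarrow> 'a \<Rightarrow> 'a \<Rightarrow> nat" where
  "graph_dist E u v = (LEAST m. (u, v) \<in> E ^^ m)"

text \<open>Lattice coordinates are functions on \<open>{1..D}\<close>, extended by \<open>undefined\<close> outside.\<close>

definition lattice_nodes :: "nat \<Rightarrow> (nat \<Rightarrow> nat) \<Rightarrow> (nat \<Rightarrow> nat) set" where
  "lattice_nodes D N = (\<Pi>\<^sub>E k\<in>{1..D}. {0..<N k})"

definition l1_dist :: "nat \<Rightarrow> (nat \<Rightarrow> nat) \<Rightarrow> (nat \<Rightarrow> nat) \<Rightarrow> nat" where
  "l1_dist D v w = (\<Sum>k=1..D. nat \<bar>int (v k) - int (w k)\<bar>)"

definition lattice_graph :: "nat \<Rightarrow> (nat \<Rightarrow> nat) \<Rightarrow> ((nat \<Rightarrow> nat) \<times> (nat \<Rightarrow> nat)) set" where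
  "lattice_graph D N =
     {(v, w). v \<in> lattice_nodes D N \<and> w \<in> lattice_nodes D N \<and> l1_dist D v w = 1}"

text \<open>\<open>crd\<close> identifies the vertices of the graph of \<open>A\<close> with the nodes of the
  \<open>N 1 \<times> \<dots> \<times> N D\<close> lattice.\<close>

definition lattice_identification ::
    "complex mat \<Rightarrow> nat \<Rightarrow> (nat \<Rightarrow> nat) \<Rightarrow> (nat \<Rightarrow> nat \<Rightarrow> nat) \<Rightarrow> bool" where
  "lattice_identification A D N crd \<longleftrightarrow>
     bij_betw crd {0..<dim_row A} (lattice_nodes D N) \<and>
     (\<forall>i<dim_row A. \<forall>j<dim_row A.
        (i, j) \<in> mat_graph A \<longleftrightarrow> (crd i, crd j) \<in> lattice_graph D N)"

definition distance_coloring :: "'a set \<Rightarrow> ('a \<times> 'a) set \<Rightarrow> nat \<Rightarrow> ('a \<Rightarrow> nat) \<Rightarrow> bool" where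
  "distance_coloring V E d c \<longleftrightarrow>
     (\<forall>u\<in>V. \<forall>v\<in>V. u \<noteq> v \<and> graph_dist E u v \<le> d \<longrightarrow> c u \<noteq> c v)"

definition lattice_col :: "nat \<Rightarrow> nat \<Rightarrow> (nat \<Rightarrow> nat) \<Rightarrow> nat" where
  "lattice_col D d w = (\<Sum>k=1..D. (w k mod (d + 1)) * (d + 1) ^ (k - 1)) + 1"

definition mat_poly :: "complex poly \<Rightarrow> complex mat \<Rightarrow> complex mat" where
  "mat_poly p A = mat (dim_row A) (dim_row A)
     (\<lambda>(i, j). \<Sum>k\<le>degree p. coeff p k * (A ^\<^sub>m k) $$ (i, j))"

text \<open>The scalar function is required to have as many derivatives at an eigenvalue \<open>\<lambda>\<close> as the
  largest Jordan block for \<open>\<lambda>\<close> demands: for a block of size \<open>m\<close> the derivatives of order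
  \<open>0, \<dots>, m - 1\<close> have to exist. The Jordan normal form is unique up to the order of its blocks, so
  quantifying over all block lists only quantifies over these orders.\<close>

definition mat_fun_defined :: "(complex \<Rightarrow> complex) \<Rightarrow> complex mat \<Rightarrow> bool" where
  "mat_fun_defined f A \<longleftrightarrow>
     (\<forall>n_as. jordan_nf A n_as \<longrightarrow>
        (\<forall>(m, ev) \<in> set n_as. \<forall>j. j + 1 < m \<longrightarrow> ((deriv ^^ j) f) field_differentiable (at ev)))"

definition hermite_interpolates :: "complex poly \<Rightarrow> (complex \<Rightarrow> complex) \<Rightarrow> complex mat \<Rightarrow> bool" where
  "hermite_interpolates p f A \<longleftrightarrow>
     (\<forall>n_as. jordan_nf A n_as \<longrightarrow>
        (\<forall>(m, ev) \<in> set n_as. \<forall>j<m. poly ((pderiv ^^ j) p) ev = (deriv ^^ j) f ev))"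

text \<open>All Hermite interpolation polynomials yield the same matrix, so the choice is immaterial.\<close>

definition mat_fun :: "(complex \<Rightarrow> complex) \<Rightarrow> complex mat \<Rightarrow> complex mat" where
  "mat_fun f A = mat_poly (SOME p. hermite_interpolates p f A) A"

definition color_vec :: "nat \<Rightarrow> (nat \<Rightarrow> nat) \<Rightarrow> nat \<Rightarrow> complex vec" where
  "color_vec n c l = finsum_vec TYPE(complex) n (unit_vec n) {i. i < n \<and> c i = l}"

text \<open>\<open>(M *\<^sub>v v) \<bullet>c v\<close> is \<open>v\<^sup>H M v\<close>, since \<open>\<bullet>c\<close> conjugates its second argument.\<close>

definition probing_trace :: "nat \<Rightarrow> (nat \<Rightarrow> nat) \<Rightarrow> complex mat \<Rightarrow> complex" where
  "probing_trace m c M =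
     (\<Sum>l=1..m. (M *\<^sub>v color_vec (dim_row M) c l) \<bullet>c color_vec (dim_row M) c l)"

text \<open>The series starts at \<open>i = 1\<close>, hence the shift of the summation index.\<close>

definition polylog :: "int \<Rightarrow> real \<Rightarrow> real" where
  "polylog s z = (\<Sum>i. z ^ Suc i / real (Suc i) powi s)"


text \<open>In the lattice, the graph distance is the \<open>1\<close>-norm distance, and \<open>lattice_col\<close> is a
  distance-\<open>d\<close> coloring with colors in \<open>{1..(d + 1) ^ D}\<close>.\<close>

lemma l1_dist_eq_0_iff:
  assumes "v \<in> lattice_nodes D N" "w \<in> lattice_nodes D N"
  shows "l1_dist D v w = 0 \<longleftrightarrow> v = w"
proof
  assume "l1_dist D v w = 0"
  hence "v k = w k" if "k \<in> {1..D}" for k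
    using that by (auto simp: l1_dist_def)
  thus "v = w"
    using assms unfolding lattice_nodes_def by (intro PiE_ext)
qed (simp add: l1_dist_def)

lemma l1_dist_triangle: "l1_dist D u w \<le> l1_dist D u v + l1_dist D v w"
  unfolding l1_dist_def sum.distrib[symmetric] by (intro sum_mono) linarith

lemma relpow_lattice_l1_dist:
  "(u, v) \<in> lattice_graph D N ^^ m \<Longrightarrow> l1_dist D u v \<le> m"
proof (induction m arbitrary: v)
  case 0
  thus ?case by (simp add: l1_dist_def)
next
  case (Suc m)
  then obtain x where x: "(u, x) \<in> lattice_graph D N ^^ m" "(x, v) \<in> lattice_graph D N"
    by auto
  have "l1_dist D u v \<le> l1_dist D u x + l1_dist D x v" by (rule l1_dist_triangle)
  thus ?case using Suc.IH[OF x(1)] x(2) by (simp add: lattice_graph_def)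
qed

lemma lattice_step:
  assumes v: "v \<in> lattice_nodes D N" and w: "w \<in> lattice_nodes D N"
    and m: "l1_dist D v w = Suc m"
  shows "\<exists>x. (v, x) \<in> lattice_graph D N \<and> l1_dist D x w = m"
proof -
  obtain k where k: "k \<in> {1..D}" "v k \<noteq> w k"
  proof -
    have "\<exists>k\<in>{1..D}. v k \<noteq> w k"
    proof (rule ccontr)
      assume "\<not> ?thesis"
      hence "l1_dist D v w = 0" by (simp add: l1_dist_def)
      thus False using m by simp
    qed
    thus thesis using that by blast
  qed
  define y where "y = (if v k < w k then v k + 1 else v k - 1)"
  define x where "x = v(k := y)"
  have vk: "v k < N k" "w k < N k"
    using v w k by (auto simp: lattice_nodes_def)
  hence y: "y < N k" by (auto simp: y_def)
  have x_node: "x \<in> lattice_nodes D N"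
    using v k y by (auto simp: lattice_nodes_def x_def PiE_iff extensional_def)
  have split: "l1_dist D a b =
      nat \<bar>int (a k) - int (b k)\<bar> + (\<Sum>i\<in>{1..D} - {k}. nat \<bar>int (a i) - int (b i)\<bar>)" for a b
    unfolding l1_dist_def using k by (intro sum.remove) auto
  have "l1_dist D v x = 1"
    using k by (simp add: split x_def y_def)
  moreover have "l1_dist D x w = m"
  proof -
    have "(\<Sum>i\<in>{1..D} - {k}. nat \<bar>int (x i) - int (w i)\<bar>) =
          (\<Sum>i\<in>{1..D} - {k}. nat \<bar>int (v i) - int (w i)\<bar>)"
      by (intro sum.cong) (auto simp: x_def)
    moreover have "nat \<bar>int (v k) - int (w k)\<bar> = Suc (nat \<bar>int (x k) - int (w k)\<bar>)"
      using k by (auto simp: x_def y_def)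
    ultimately show ?thesis using m split[of v w] split[of x w] by linarith
  qed
  ultimately show ?thesis using v x_node by (auto simp: lattice_graph_def)
qed

lemma lattice_walk:
  assumes "v \<in> lattice_nodes D N" "w \<in> lattice_nodes D N"
  shows "(v, w) \<in> lattice_graph D N ^^ (l1_dist D v w)"
proof -
  have "(v, w) \<in> lattice_graph D N ^^ m"
    if "v \<in> lattice_nodes D N" "l1_dist D v w = m" for v m
    using that
  proof (induction m arbitrary: v)
    case 0
    thus ?case using l1_dist_eq_0_iff assms(2) by auto
  next
    case (Suc m)
    then obtain x where x: "(v, x) \<in> lattice_graph D N" "l1_dist D x w = m"
      using lattice_step assms(2) by blast
    have "(x, w) \<in> lattice_graph D N ^^ m"
      using x by (intro Suc.IH) (auto simp: lattice_graph_def)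
    thus ?case using x(1) by (blast intro: relpow_Suc_I2)
  qed
  thus ?thesis using assms by blast
qed

lemma graph_dist_lattice:
  assumes "v \<in> lattice_nodes D N" "w \<in> lattice_nodes D N"
  shows "graph_dist (lattice_graph D N) v w = l1_dist D v w"
  unfolding graph_dist_def
  by (intro Least_equality lattice_walk relpow_lattice_l1_dist assms)

lemma digit_sum_less:
  fixes b :: nat
  assumes "\<And>k. a k < b"
  shows "(\<Sum>k=1..D. a k * b ^ (k - 1)) < b ^ D"
proof (induction D)
  case (Suc D)
  have "(\<Sum>k=1..Suc D. a k * b ^ (k - 1)) < b ^ D + a (Suc D) * b ^ D"
    using Suc by simp
  also have "\<dots> = Suc (a (Suc D)) * b ^ D" by simp
  also have "\<dots> \<le> b * b ^ D"
    using assms[of "Suc D"] by (intro mult_right_mono) auto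
  finally show ?case by simp
qed simp

lemma digit_sum_inj:
  fixes b :: nat
  assumes a: "\<And>k. a k < b" and a': "\<And>k. a' k < b"
    and "(\<Sum>k=1..D. a k * b ^ (k - 1)) = (\<Sum>k=1..D. a' k * b ^ (k - 1))" and "k \<in> {1..D}"
  shows "a k = a' k"
  using assms(3,4)
proof (induction D)
  case (Suc D)
  define S where "S = (\<lambda>a. \<Sum>k=1..D. a k * b ^ (k - 1))"
  have less: "S a < b ^ D" "S a' < b ^ D"
    unfolding S_def using digit_sum_less a a' by blast+
  have eq: "S a + a (Suc D) * b ^ D = S a' + a' (Suc D) * b ^ D"
    using Suc.prems by (simp add: S_def)
  have "b ^ D \<noteq> 0" using less by linarith
  hence "(S a + a (Suc D) * b ^ D) div b ^ D = a (Suc D)"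
       "(S a' + a' (Suc D) * b ^ D) div b ^ D = a' (Suc D)"
    using less by (simp_all add: div_mult_self3 div_less)
  hence top: "a (Suc D) = a' (Suc D)" using eq by simp
  hence "S a = S a'" using eq by simp
  thus ?case using Suc top by (cases "k = Suc D") (auto simp: S_def)
qed simp

lemma lattice_col_range: "lattice_col D d w \<in> {1..(d + 1) ^ D}"
  using digit_sum_less[of "\<lambda>k. w k mod (d + 1)" "d + 1" D] by (simp add: lattice_col_def)

lemma distance_coloring_lattice_col:
  "distance_coloring (lattice_nodes D N) (lattice_graph D N) d (lattice_col D d)"
  unfolding distance_coloring_def
proof (intro ballI impI notI, elim conjE)
  fix v w
  assume vw: "v \<in> lattice_nodes D N" "w \<in> lattice_nodes D N" "v \<noteq> w"
    and dist: "graph_dist (lattice_graph D N) v w \<le> d"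
    and col: "lattice_col D d v = lattice_col D d w"
  have "v k = w k" if k: "k \<in> {1..D}" for k
  proof -
    have "nat \<bar>int (v k) - int (w k)\<bar> \<le> l1_dist D v w"
      unfolding l1_dist_def using k by (intro member_le_sum) auto
    hence le: "\<bar>int (v k) - int (w k)\<bar> \<le> int d"
      using dist graph_dist_lattice[OF vw(1,2)] by linarith
    have "v k mod (d + 1) = w k mod (d + 1)"
      using digit_sum_inj[of "\<lambda>k. v k mod (d + 1)" "d + 1" "\<lambda>k. w k mod (d + 1)" D k] col k
      by (simp add: lattice_col_def)
    hence "int (v k) mod int (d + 1) = int (w k) mod int (d + 1)"
      by (metis zmod_int)
    hence "int (d + 1) dvd int (v k) - int (w k)"
      by (simp add: mod_eq_dvd_iff)
    thus ?thesis
      using le dvd_imp_le_int[of "int (v k) - int (w k)" "int (d + 1)"] by fastforce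
  qed
  hence "v = w" using vw unfolding lattice_nodes_def by (intro PiE_ext)
  thus False using vw by blast
qed

end

theory Submission
  imports Defs
begin

text \<open>The error \<open>tr(f(A)) - T(f(A))\<close> is minus the sum of the entries \<open>(i, j)\<close> with \<open>i \<noteq> j\<close> of equal
  color. Two nodes of equal color differ by \<open>(d + 1) u\<close> for a nonzero integer vector \<open>u\<close>, so such an
  entry is at most \<open>C q\<^sup>(\<^sup>d\<^sup>+\<^sup>1\<^sup>)\<^sup>r \<le> C (q\<^sup>d)\<^sup>r\<close> with \<open>r = \<parallel>u\<parallel>\<^sub>1\<close>. There are at most \<open>2 D r\<^sup>D\<^sup>-\<^sup>1\<close> integer
  vectors of norm \<open>r\<close>, by induction on \<open>D\<close>: fixing the last coordinate gives
  \<open>L(D + 1, r) \<le> L(D, r) + 2 \<Sum>\<^sub>s\<^sub><\<^sub>r L(D, s)\<close>. Summing over \<open>r\<close> produces the polylogarithm series in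
  each of the \<open>n\<close> rows.\<close>

section \<open>Transfer of distances to the lattice\<close>

text \<open>The edge sets live on \<open>V\<close> and \<open>W\<close>, so every intermediate
  vertex of a walk can be transported along \<open>h\<close>.\<close>

lemma relpow_bij_betw_iff:
  assumes h: "bij_betw h V W" and E: "E \<subseteq> V \<times> V" and E': "E' \<subseteq> W \<times> W"
    and iff: "\<And>x y. x \<in> V \<Longrightarrow> y \<in> V \<Longrightarrow> (x, y) \<in> E \<longleftrightarrow> (h x, h y) \<in> E'"
    and "x \<in> V" "y \<in> V"
  shows "(x, y) \<in> E ^^ m \<longleftrightarrow> (h x, h y) \<in> E' ^^ m"
  using \<open>y \<in> V\<close>
proof (induction m arbitrary: y)
  case 0
  thus ?case using bij_betw_imp_inj_on[OF h] \<open>x \<in> V\<close> by (auto dest: inj_onD)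
next
  case (Suc m)
  have "(x, y) \<in> E ^^ Suc m \<longleftrightarrow> (\<exists>z\<in>V. (x, z) \<in> E ^^ m \<and> (z, y) \<in> E)"
    using E by auto
  also have "\<dots> \<longleftrightarrow> (\<exists>z\<in>V. (h x, h z) \<in> E' ^^ m \<and> (h z, h y) \<in> E')"
    using Suc iff by blast
  also have "\<dots> \<longleftrightarrow> (\<exists>z\<in>W. (h x, z) \<in> E' ^^ m \<and> (z, h y) \<in> E')"
    using bij_betw_imp_surj_on[OF h] by blast
  also have "\<dots> \<longleftrightarrow> (h x, h y) \<in> E' ^^ Suc m"
    using E' by auto
  finally show ?case .
qed

lemma graph_dist_mat_graph:
  assumes A: "A \<in> carrier_mat n n" and id: "lattice_identification A D N crd"
    and i: "i < n" and j: "j < n"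
  shows "graph_dist (mat_graph A) i j = l1_dist D (crd i) (crd j)"
proof -
  have bij: "bij_betw crd {0..<n} (lattice_nodes D N)"
    using A id by (simp add: lattice_identification_def)
  have "(i, j) \<in> mat_graph A ^^ m \<longleftrightarrow> (crd i, crd j) \<in> lattice_graph D N ^^ m" for m
  proof (rule relpow_bij_betw_iff[OF bij])
    show "mat_graph A \<subseteq> {0..<n} \<times> {0..<n}"
      using A by (auto simp: mat_graph_def)
    show "lattice_graph D N \<subseteq> lattice_nodes D N \<times> lattice_nodes D N"
      by (auto simp: lattice_graph_def)
    show "(x, y) \<in> mat_graph A \<longleftrightarrow> (crd x, crd y) \<in> lattice_graph D N"
      if "x \<in> {0..<n}" "y \<in> {0..<n}" for x y
      using id A that unfolding lattice_identification_def by auto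
  qed (use i j in auto)
  hence "graph_dist (mat_graph A) i j = graph_dist (lattice_graph D N) (crd i) (crd j)"
    by (simp add: graph_dist_def)
  also have "\<dots> = l1_dist D (crd i) (crd j)"
    using bij_betwE[OF bij] i j by (intro graph_dist_lattice) auto
  finally show ?thesis .
qed

section \<open>Probing trace as a sum of matrix entries\<close>

lemma color_vec_eq: "color_vec n c l = vec n (\<lambda>i. if c i = l then 1 else 0)"
proof (rule eq_vecI)
  have carrier: "(unit_vec n :: nat \<Rightarrow> complex vec) \<in> {i. i < n \<and> c i = l} \<rightarrow> carrier_vec n"
    by simp
  show "dim_vec (color_vec n c l) = dim_vec (vec n (\<lambda>i. if c i = l then 1 else 0 :: complex))"
    using finsum_vec_closed[OF carrier] by (simp add: color_vec_def)
  fix i assume "i < dim_vec (vec n (\<lambda>i. if c i = l then 1 else 0 :: complex))"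
  hence i: "i < n" by simp
  have "color_vec n c l $ i = (\<Sum>j | j < n \<and> c j = l. unit_vec n j $ i)"
    unfolding color_vec_def using i carrier by (intro index_finsum_vec) auto
  also have "\<dots> = (\<Sum>j | j < n \<and> c j = l. if j = i then 1 else 0)"
    using i by (intro sum.cong) auto
  also have "\<dots> = (if c i = l then 1 else 0)"
    using i by (simp add: sum.delta')
  finally show "color_vec n c l $ i = vec n (\<lambda>i. if c i = l then 1 else 0) $ i"
    using i by simp
qed

text \<open>The quadratic form of color \<open>l\<close> adds the entries with both indices of color
  \<open>l\<close>. The range of \<open>c\<close> puts each row \<open>i\<close> in exactly one
  class counted by the sum over \<open>l\<close>.\<close>

lemma probing_trace_eq:
  assumes M: "M \<in> carrier_mat n n" and c: "\<And>i. i < n \<Longrightarrow> c i \<in> {1..m}"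
  shows "probing_trace m c M = (\<Sum>i<n. \<Sum>j | j < n \<and> c j = c i. M $$ (i, j))"
proof -
  have row: "(M *\<^sub>v color_vec n c l) $ i = (\<Sum>j | j < n \<and> c j = l. M $$ (i, j))"
    if "i < n" for i l
  proof -
    have "(M *\<^sub>v color_vec n c l) $ i = (\<Sum>j = 0..<n. M $$ (i, j) * (if c j = l then 1 else 0))"
      using M that by (simp add: color_vec_eq scalar_prod_def)
    also have "\<dots> = (\<Sum>j = 0..<n. if c j = l then M $$ (i, j) else 0)"
      by (intro sum.cong) auto
    also have "\<dots> = (\<Sum>j | j < n \<and> c j = l. M $$ (i, j))"
      by (subst sum.inter_filter[symmetric]) (auto intro: sum.cong)
    finally show ?thesis .
  qed
  \<comment> \<open>The inner sum refers to \<open>c i\<close> instead of \<open>l\<close>, so that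
    after swapping the sums the one over \<open>l\<close> collapses.\<close>
  have "probing_trace m c M = (\<Sum>l=1..m. \<Sum>i<n. if l = c i then
          (\<Sum>j | j < n \<and> c j = c i. M $$ (i, j)) else 0)"
    unfolding probing_trace_def
  proof (rule sum.cong[OF refl])
    fix l
    have "(M *\<^sub>v color_vec n c l) \<bullet>c color_vec n c l =
          (\<Sum>i = 0..<n. (M *\<^sub>v color_vec n c l) $ i * cnj (if c i = l then 1 else 0))"
      by (simp add: scalar_prod_def color_vec_eq conjugate_complex_def)
    also have "\<dots> = (\<Sum>i<n. if l = c i then (\<Sum>j | j < n \<and> c j = c i. M $$ (i, j)) else 0)"
      by (intro sum.cong) (auto simp: row)
    finally show "(M *\<^sub>v color_vec (dim_row M) c l) \<bullet>c color_vec (dim_row M) c l =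
        (\<Sum>i<n. if l = c i then (\<Sum>j | j < n \<and> c j = c i. M $$ (i, j)) else 0)"
      using M by simp
  qed
  also have "\<dots> = (\<Sum>i<n. \<Sum>l=1..m. if l = c i then
          (\<Sum>j | j < n \<and> c j = c i. M $$ (i, j)) else 0)"
    by (rule sum.swap)
  also have "\<dots> = (\<Sum>i<n. \<Sum>j | j < n \<and> c j = c i. M $$ (i, j))"
    using c by (intro sum.cong[OF refl]) (subst sum.delta, simp_all)
  finally show ?thesis .
qed

text \<open>Every index shares its own color, so the diagonal cancels.\<close>

lemma trace_minus_probing_trace:
  assumes M: "M \<in> carrier_mat n n" and c: "\<And>i. i < n \<Longrightarrow> c i \<in> {1..m}"
  shows "mat_trace M - probing_trace m c M =
    - (\<Sum>i<n. \<Sum>j | j < n \<and> j \<noteq> i \<and> c j = c i. M $$ (i, j))"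
proof -
  have "(\<Sum>j | j < n \<and> c j = c i. M $$ (i, j)) =
        M $$ (i, i) + (\<Sum>j | j < n \<and> j \<noteq> i \<and> c j = c i. M $$ (i, j))" if "i < n" for i
  proof -
    have "{j. j < n \<and> c j = c i} = insert i {j. j < n \<and> j \<noteq> i \<and> c j = c i}"
      using that by auto
    thus ?thesis by simp
  qed
  thus ?thesis
    using M by (simp add: probing_trace_eq[OF M c] mat_trace_def sum.distrib)
qed

section \<open>Counting integer vectors of given 1-norm\<close>

text \<open>Extensionality gives each integer vector a single representative, so cardinalities count
  vectors.\<close>

definition int_sphere :: "nat \<Rightarrow> nat \<Rightarrow> (nat \<Rightarrow> int) set" where
  "int_sphere D r = {u \<in> {1..D} \<rightarrow>\<^sub>E UNIV. (\<Sum>k=1..D. nat \<bar>u k\<bar>) = r}"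

text \<open>If the first \<open>D\<close> coordinates have norm \<open>s\<close>, the last one has
  absolute value \<open>r - s\<close>: it vanishes for \<open>s = r\<close> and has two possible
  signs for \<open>s < r\<close>.\<close>

lemma int_sphere_Suc_subset:
  "int_sphere (Suc D) r \<subseteq>
     (\<lambda>u. u(Suc D := 0)) ` int_sphere D r \<union>
     (\<Union>s<r. (\<lambda>u. u(Suc D := int (r - s))) ` int_sphere D s \<union>
              (\<lambda>u. u(Suc D := - int (r - s))) ` int_sphere D s)"
proof
  fix u assume u: "u \<in> int_sphere (Suc D) r"
  \<comment> \<open>Dropping a coordinate means resetting it to \<open>undefined\<close>, which
    keeps \<open>v\<close> extensional.\<close>
  define v where "v = u(Suc D := undefined)"
  define s where "s = (\<Sum>k=1..D. nat \<bar>u k\<bar>)"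
  have "(\<Sum>k=1..D. nat \<bar>v k\<bar>) = s"
    unfolding s_def v_def by (intro sum.cong) auto
  hence v: "v \<in> int_sphere D s"
    using u by (auto simp: int_sphere_def v_def PiE_iff extensional_def)
  have s: "s + nat \<bar>u (Suc D)\<bar> = r"
    using u by (simp add: int_sphere_def s_def)
  have uv: "u = v(Suc D := u (Suc D))" by (simp add: v_def)
  consider "u (Suc D) = 0" "s = r" | "s < r" "u (Suc D) = int (r - s)"
    | "s < r" "u (Suc D) = - int (r - s)"
    using s by linarith
  thus "u \<in> (\<lambda>u. u(Suc D := 0)) ` int_sphere D r \<union>
     (\<Union>s<r. (\<lambda>u. u(Suc D := int (r - s))) ` int_sphere D s \<union>
              (\<lambda>u. u(Suc D := - int (r - s))) ` int_sphere D s)"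
    by cases (use uv v in \<open>auto intro!: image_eqI[of _ _ v]\<close>)
qed

lemma finite_int_sphere: "finite (int_sphere D r)"
proof (induction D arbitrary: r)
  case 0
  show ?case by (simp add: int_sphere_def)
next
  case (Suc D)
  show ?case by (rule finite_subset[OF int_sphere_Suc_subset]) (auto simp: Suc)
qed

lemma card_int_sphere_Suc_le:
  "card (int_sphere (Suc D) r) \<le>
     card (int_sphere D r) + 2 * (\<Sum>s<r. card (int_sphere D s))"
proof -
  let ?f = "\<lambda>t u. u(Suc D := t :: int)"
  have img: "card (?f t ` int_sphere D s) \<le> card (int_sphere D s)" for t s
    by (intro card_image_le finite_int_sphere)
  have "card (int_sphere (Suc D) r) \<le> card (?f 0 ` int_sphere D r \<union>
     (\<Union>s<r. ?f (int (r - s)) ` int_sphere D s \<union> ?f (- int (r - s)) ` int_sphere D s))"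
    by (intro card_mono int_sphere_Suc_subset) (auto simp: finite_int_sphere)
  also have "\<dots> \<le> card (?f 0 ` int_sphere D r) +
     (\<Sum>s<r. card (?f (int (r - s)) ` int_sphere D s \<union> ?f (- int (r - s)) ` int_sphere D s))"
    by (intro order.trans[OF card_Un_le] add_left_mono card_UN_le) auto
  also have "\<dots> \<le> card (int_sphere D r) + (\<Sum>s<r. 2 * card (int_sphere D s))"
  proof (intro add_mono sum_mono img)
    fix s
    show "card (?f (int (r - s)) ` int_sphere D s \<union> ?f (- int (r - s)) ` int_sphere D s)
            \<le> 2 * card (int_sphere D s)"
      using img[of "int (r - s)" s] img[of "- int (r - s)" s]
      by (intro order.trans[OF card_Un_le]) linarith
  qed
  finally show ?thesis by (simp add: sum_distrib_left)
qed

text \<open>For \<open>D = 0\<close> the exponent \<open>D - 1\<close> is truncated, but the factor \<open>D\<close> gives the correct value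
  \<open>0\<close>, so the induction on \<open>D\<close> can start there.\<close>

definition sphere_bound :: "nat \<Rightarrow> nat \<Rightarrow> nat" where
  "sphere_bound D r = (if r = 0 then 1 else 2 * D * r ^ (D - 1))"

text \<open>This is the induction step of the next lemma: passing from \<open>r\<close> to
  \<open>Suc r\<close> raises its left side by the first two summands.\<close>

lemma sphere_bound_increment:
  assumes "r > 0"
  shows "sphere_bound D (Suc r) + sphere_bound D r + sphere_bound (Suc D) r
           \<le> sphere_bound (Suc D) (Suc r)"
proof (cases "D \<le> 1")
  case True
  thus ?thesis using assms by (cases D) (auto simp: sphere_bound_def)
next
  case False
  then obtain e where D: "D = Suc (Suc e)"
    by (metis One_nat_def Suc_le_mono le0 not0_implies_Suc)
  \<comment> \<open>With \<open>a = (r + 1)^(D - 1)\<close> and \<open>b = r^(D - 1)\<close>, half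
    the claim reads \<open>D * (a + b) + (D + 1) * r * b \<le> (D + 1) * (r + 1) * a\<close>. It
    follows from \<open>(r + 1) * b \<le> r * a\<close>, that is, from monotonicity of the power
    \<open>e\<close>.\<close>
  define a where "a = (Suc r) ^ Suc e"
  define b where "b = r ^ Suc e"
  have "Suc r * b = r * Suc r * r ^ e" by (simp add: b_def algebra_simps)
  also have "\<dots> \<le> r * Suc r * Suc r ^ e"
    by (intro mult_le_mono2 power_mono) auto
  also have "\<dots> = r * a" by (simp add: a_def algebra_simps)
  finally have *: "a + b + r * b \<le> Suc r * a" by simp
  have "D * (a + b) \<le> Suc D * (a + b)" by simp
  moreover have "Suc D * (a + b) + Suc D * (r * b) \<le> Suc D * (Suc r * a)"
    using mult_le_mono2[OF *, of "Suc D"] by (simp only: distrib_left)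
  ultimately show ?thesis
    using assms by (simp add: sphere_bound_def D a_def b_def algebra_simps)
qed

lemma sphere_bound_Suc:
  "sphere_bound D r + 2 * (\<Sum>s<r. sphere_bound D s) \<le> sphere_bound (Suc D) r"
proof (induction r)
  case 0
  show ?case by (simp add: sphere_bound_def)
next
  case (Suc r)
  show ?case
  proof (cases "r = 0")
    \<comment> \<open>At radius 1 the sum is the single value 1 at radius 0, and both sides equal
      \<open>2 * D + 2\<close>.\<close>
    case True
    thus ?thesis by (simp add: sphere_bound_def)
  next
    case False
    thus ?thesis using Suc sphere_bound_increment[of r D] by simp
  qed
qed

lemma card_int_sphere_le: "card (int_sphere D r) \<le> sphere_bound D r"
proof (induction D arbitrary: r)
  case 0
  show ?case
    by (cases "r = 0") (auto simp: int_sphere_def sphere_bound_def)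
next
  case (Suc D)
  have "card (int_sphere (Suc D) r) \<le>
          card (int_sphere D r) + 2 * (\<Sum>s<r. card (int_sphere D s))"
    by (rule card_int_sphere_Suc_le)
  also have "\<dots> \<le> sphere_bound D r + 2 * (\<Sum>s<r. sphere_bound D s)"
    by (intro add_mono mult_le_mono2 sum_mono Suc)
  also have "\<dots> \<le> sphere_bound (Suc D) r"
    by (rule sphere_bound_Suc)
  finally show ?case .
qed

section \<open>The polylogarithm series\<close>

lemma polylog_nonpos_term:
  assumes "D \<ge> 1"
  shows "z ^ Suc i / real (Suc i) powi (1 - int D) = real (Suc i) ^ (D - 1) * z ^ Suc i"
proof -
  have "1 - int D = - int (D - 1)" using assms by simp
  hence "real (Suc i) powi (1 - int D) = inverse (real (Suc i) ^ (D - 1))"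
    by (simp only: power_int_minus power_int_of_nat)
  thus ?thesis by (simp add: field_simps)
qed

text \<open>Termwise differentiation turns the coefficients \<open>i^k\<close> into
  \<open>(i + 1)^(k + 1)\<close>. It needs convergence on the whole unit disc, hence the induction
  with \<open>z\<close> arbitrary.\<close>

lemma summable_power_mult_geometric:
  fixes z :: real
  assumes "\<bar>z\<bar> < 1"
  shows "summable (\<lambda>i. real i ^ k * z ^ i)"
  using assms
proof (induction k arbitrary: z)
  case 0
  thus ?case by (simp add: summable_geometric)
next
  case (Suc k)
  have "summable (\<lambda>i. diffs (\<lambda>i. real i ^ k) i * z ^ i)"
    using Suc by (intro termdiff_converges[where K = 1]) auto
  hence "summable (\<lambda>i. real (Suc i) ^ Suc k * z ^ i)"
    by (simp add: diffs_def)
  hence "summable (\<lambda>i. z * (real (Suc i) ^ Suc k * z ^ i))"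
    by (rule summable_mult)
  hence "summable (\<lambda>i. real (Suc i) ^ Suc k * z ^ Suc i)"
    by (simp add: mult_ac)
  thus ?case
    by (subst summable_Suc_iff[symmetric])
qed

text \<open>Grouping by norm leaves at most \<open>sphere_bound D (Suc r)\<close> equal terms per
  group; the terms of the series are nonnegative, so it dominates the finite sum.\<close>

lemma sum_le_polylog:
  assumes D: "D \<ge> 1" and z: "0 \<le> z" "z < 1" and "finite U"
    and U: "U \<subseteq> (\<Union>r. int_sphere D (Suc r))"
  shows "(\<Sum>u\<in>U. z ^ (\<Sum>k=1..D. nat \<bar>u k\<bar>)) \<le> 2 * real D * polylog (1 - int D) z"
proof -
  let ?norm = "\<lambda>u. \<Sum>k=1..D. nat \<bar>u k :: int\<bar>"
  let ?t = "\<lambda>i. real (Suc i) ^ (D - 1) * z ^ Suc i"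
  \<comment> \<open>Norms in \<open>U\<close> are positive; subtracting 1 matches the shifted index
    of \<open>polylog\<close>.\<close>
  define R where "R = (\<lambda>u. ?norm u - 1) ` U"
  have norm: "?norm u = Suc (?norm u - 1)" if "u \<in> U" for u
    using U that by (auto simp: int_sphere_def)
  have "finite R" using \<open>finite U\<close> by (simp add: R_def)
  have "(\<Sum>u\<in>U. z ^ ?norm u) = (\<Sum>r\<in>R. \<Sum>u | u \<in> U \<and> ?norm u - 1 = r. z ^ ?norm u)"
    unfolding R_def by (rule sum.image_gen[OF \<open>finite U\<close>])
  also have "\<dots> \<le> (\<Sum>r\<in>R. 2 * real D * ?t r)"
  proof (rule sum_mono)
    fix r
    have "(\<Sum>u | u \<in> U \<and> ?norm u - 1 = r. z ^ ?norm u) =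
          (\<Sum>u | u \<in> U \<and> ?norm u - 1 = r. z ^ Suc r)"
    proof (rule sum.cong[OF refl])
      fix u assume "u \<in> {u \<in> U. ?norm u - 1 = r}"
      hence "?norm u = Suc r" using norm[of u] by simp
      thus "z ^ ?norm u = z ^ Suc r" by (rule arg_cong)
    qed
    also have "\<dots> = real (card {u \<in> U. ?norm u - 1 = r}) * z ^ Suc r" by simp
    also have "{u \<in> U. ?norm u - 1 = r} \<subseteq> int_sphere D (Suc r)"
      using U by (auto simp: int_sphere_def)
    hence "card {u \<in> U. ?norm u - 1 = r} \<le> sphere_bound D (Suc r)"
      by (meson card_mono finite_int_sphere card_int_sphere_le order.trans)
    hence "real (card {u \<in> U. ?norm u - 1 = r}) * z ^ Suc r \<le> real (sphere_bound D (Suc r)) * z ^ Suc r"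
      using z by (intro mult_right_mono) auto
    also have "\<dots> = 2 * real D * ?t r" by (simp add: sphere_bound_def)
    finally show "(\<Sum>u | u \<in> U \<and> ?norm u - 1 = r. z ^ ?norm u) \<le> 2 * real D * ?t r" .
  qed
  also have "\<dots> = 2 * real D * (\<Sum>r\<in>R. ?t r)" by (simp add: sum_distrib_left)
  also have "\<dots> \<le> 2 * real D * (\<Sum>i. ?t i)"
  proof (intro mult_left_mono sum_le_suminf)
    show "summable ?t"
      using z summable_power_mult_geometric[of z "D - 1"] by (subst summable_Suc_iff) simp
  qed (use z \<open>finite R\<close> in auto)
  also have "(\<Sum>i. ?t i) = polylog (1 - int D) z"
    unfolding polylog_def polylog_nonpos_term[OF D] ..
  finally show ?thesis .
qed

section \<open>Decay within one color class\<close>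

lemma same_color_sum_le:
  assumes D: "D \<ge> 1" and d: "d \<ge> 1" and q: "0 \<le> q" "q < 1" and "finite W"
    and W: "W \<subseteq> lattice_nodes D N" and v: "v \<in> lattice_nodes D N" "v \<notin> W"
    and col: "\<And>w. w \<in> W \<Longrightarrow> lattice_col D d w = lattice_col D d v"
  shows "(\<Sum>w\<in>W. q ^ l1_dist D v w) \<le> 2 * real D * polylog (1 - int D) (q ^ d)"
proof -
  \<comment> \<open>The quotient vector of \<open>w - v\<close> by \<open>d + 1\<close>; the
    division is exact because equal colors have equal base-\<open>(d + 1)\<close> digits, which are
    the residues of the coordinates.\<close>
  define \<phi> where "\<phi> = (\<lambda>w. \<lambda>k\<in>{1..D}. (int (w k) - int (v k)) div int (d + 1))"
  have diff: "int (w k) - int (v k) = int (d + 1) * \<phi> w k" if "w \<in> W" "k \<in> {1..D}" for w k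
  proof -
    have "w k mod (d + 1) = v k mod (d + 1)"
      using digit_sum_inj[of "\<lambda>k. w k mod (d + 1)" "d + 1" "\<lambda>k. v k mod (d + 1)" D k] col that
      by (simp add: lattice_col_def)
    hence "int (w k) mod int (d + 1) = int (v k) mod int (d + 1)"
      by (metis zmod_int)
    hence "int (d + 1) dvd int (w k) - int (v k)"
      by (simp add: mod_eq_dvd_iff)
    thus ?thesis using that by (simp add: \<phi>_def)
  qed
  have dist: "l1_dist D v w = (d + 1) * (\<Sum>k=1..D. nat \<bar>\<phi> w k\<bar>)" if "w \<in> W" for w
    unfolding l1_dist_def sum_distrib_left
  proof (rule sum.cong[OF refl])
    fix k assume "k \<in> {1..D}"
    have "\<bar>int (v k) - int (w k)\<bar> = int (d + 1) * \<bar>\<phi> w k\<bar>"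
      using diff[OF that \<open>k \<in> {1..D}\<close>] by (subst abs_minus_commute) (simp only: abs_mult abs_of_nat)
    thus "nat \<bar>int (v k) - int (w k)\<bar> = (d + 1) * nat \<bar>\<phi> w k\<bar>"
      by (simp only: nat_mult_distrib of_nat_0_le_iff nat_int)
  qed
  have inj: "inj_on \<phi> W"
  proof (rule inj_onI)
    fix w w' assume w: "w \<in> W" "w' \<in> W" "\<phi> w = \<phi> w'"
    have "w k = w' k" if "k \<in> {1..D}" for k
      using diff[OF w(1) that] diff[OF w(2) that] w(3) by simp
    moreover have "w \<in> lattice_nodes D N" "w' \<in> lattice_nodes D N" using w(1,2) W by auto
    ultimately show "w = w'" unfolding lattice_nodes_def by (intro PiE_ext)
  qed
  have "\<phi> ` W \<subseteq> (\<Union>r. int_sphere D (Suc r))"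
  proof clarify
    fix w assume w: "w \<in> W"
    \<comment> \<open>Since \<open>v\<close> is not in \<open>W\<close>, the zero vector is not
      hit.\<close>
    hence "l1_dist D v w \<noteq> 0" using l1_dist_eq_0_iff v W by blast
    hence "(\<Sum>k=1..D. nat \<bar>\<phi> w k\<bar>) \<noteq> 0" using dist[OF w] by (metis mult_0_right)
    then obtain r where "(\<Sum>k=1..D. nat \<bar>\<phi> w k\<bar>) = Suc r" using not0_implies_Suc by blast
    moreover have "\<phi> w \<in> {1..D} \<rightarrow>\<^sub>E UNIV" by (simp add: \<phi>_def)
    ultimately show "\<phi> w \<in> (\<Union>r. int_sphere D (Suc r))" by (auto simp: int_sphere_def)
  qed
  note bound = sum_le_polylog[OF D _ _ finite_imageI[OF \<open>finite W\<close>] this, of "q ^ d"]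
  have "(\<Sum>w\<in>W. q ^ l1_dist D v w) \<le> (\<Sum>w\<in>W. (q ^ d) ^ (\<Sum>k=1..D. nat \<bar>\<phi> w k\<bar>))"
  proof (rule sum_mono)
    fix w assume w: "w \<in> W"
    \<comment> \<open>The factor \<open>d + 1\<close> in the exponent is weakened to
      \<open>d\<close>, which is allowed as \<open>q\<close> lies in the unit interval.\<close>
    show "q ^ l1_dist D v w \<le> (q ^ d) ^ (\<Sum>k=1..D. nat \<bar>\<phi> w k\<bar>)"
      unfolding dist[OF w] power_mult[symmetric]
      using q by (intro power_decreasing mult_le_mono1) auto
  qed
  also have "\<dots> = (\<Sum>u\<in>\<phi> ` W. (q ^ d) ^ (\<Sum>k=1..D. nat \<bar>u k\<bar>))"
    by (simp add: sum.reindex[OF inj])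
  also have "\<dots> \<le> 2 * real D * polylog (1 - int D) (q ^ d)"
    \<comment> \<open>Positivity of \<open>d\<close> makes \<open>q ^ d < 1\<close>, as the series
      requires.\<close>
    using q d by (intro bound) (auto simp: power_less_one_iff)
  finally show ?thesis .
qed

theorem theorem4p2:
  fixes A :: "complex mat" and f :: "complex \<Rightarrow> complex"
    and D d n :: nat and N :: "nat \<Rightarrow> nat" and crd :: "nat \<Rightarrow> nat \<Rightarrow> nat"
    and C q :: real
  assumes "D \<ge> 1" and "\<forall>k\<in>{1..D}. N k \<ge> 1"
    and "n = (\<Prod>k=1..D. N k)"
    and "A \<in> carrier_mat n n"
    and "lattice_identification A D N crd"
    and "mat_fun_defined f A"
    and "C > 0" and "0 \<le> q" and "q < 1"
    and "\<forall>i<n. \<forall>j<n. cmod (mat_fun f A $$ (i, j)) \<le> C * q ^ graph_dist (mat_graph A) i j"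
    and "d \<ge> 1"
  shows "cmod (mat_trace (mat_fun f A)
           - probing_trace ((d + 1) ^ D) (\<lambda>i. lattice_col D d (crd i)) (mat_fun f A))
         \<le> 2 * C * real D * real n * polylog (1 - int D) (q ^ d)"
proof -
  let ?F = "mat_fun f A" and ?c = "\<lambda>i. lattice_col D d (crd i)"
  let ?J = "\<lambda>i. {j. j < n \<and> j \<noteq> i \<and> ?c j = ?c i}"
  let ?L = "polylog (1 - int D) (q ^ d)"
  have F: "?F \<in> carrier_mat n n"
    using assms(4) by (simp add: mat_fun_def mat_poly_def)
  have bij: "bij_betw crd {0..<n} (lattice_nodes D N)"
    using assms(4,5) by (simp add: lattice_identification_def)
  \<comment> \<open>For a fixed row, \<open>crd\<close> maps the other indices of the same color
    injectively to lattice nodes different from \<open>crd i\<close>.\<close>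
  have row: "(\<Sum>j\<in>?J i. cmod (?F $$ (i, j))) \<le> C * (2 * real D * ?L)" if i: "i < n" for i
  proof -
    have inj: "inj_on crd (?J i)"
      by (rule inj_on_subset[OF bij_betw_imp_inj_on[OF bij]]) auto
    have "(\<Sum>j\<in>?J i. cmod (?F $$ (i, j))) \<le> (\<Sum>j\<in>?J i. C * q ^ l1_dist D (crd i) (crd j))"
      using assms(10) i by (intro sum_mono) (auto simp flip: graph_dist_mat_graph[OF assms(4,5)])
    also have "\<dots> = C * (\<Sum>w\<in>crd ` ?J i. q ^ l1_dist D (crd i) w)"
      by (simp add: sum.reindex[OF inj] sum_distrib_left)
    also have "\<dots> \<le> C * (2 * real D * ?L)"
    proof (intro mult_left_mono same_color_sum_le)
      show "crd ` ?J i \<subseteq> lattice_nodes D N" "crd i \<in> lattice_nodes D N"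
        using bij_betwE[OF bij] i by auto
      show "crd i \<notin> crd ` ?J i"
        using bij_betw_imp_inj_on[OF bij] i by (auto dest: inj_onD)
    qed (use assms in auto)
    finally show ?thesis .
  qed
  have "cmod (mat_trace ?F - probing_trace ((d + 1) ^ D) ?c ?F) =
        cmod (\<Sum>i<n. \<Sum>j\<in>?J i. ?F $$ (i, j))"
    \<comment> \<open>The norm absorbs the sign, and all colors lie in
      \<open>{1..(d + 1) ^ D}\<close>.\<close>
    by (subst trace_minus_probing_trace[OF F]) (use lattice_col_range in auto)
  also have "\<dots> \<le> (\<Sum>i<n. \<Sum>j\<in>?J i. cmod (?F $$ (i, j)))"
    by (intro sum_norm_le norm_sum)
  also have "\<dots> \<le> (\<Sum>i<n. C * (2 * real D * ?L))"
    using row by (intro sum_mono) auto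
  also have "\<dots> = 2 * C * real D * real n * ?L" by simp
  finally show ?thesis .
qed

end
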